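(* Let $0<p\le 1$, let $s\ge 1$ be an integer, and let $A\in\mathbb{R}^{m\times n}$. Suppose that $A$ satisfies the extended null space property of order $s$ with exponent $p$ and parameter $c=\frac12-\frac14 s^{-p/2+p^2/2}$, and that $$\inf_{v\in\ker(A)\setminus\{0\}}\frac{\|v\|_p}{\|v\|_2}\ \ge\ 2^{1/p}s^{1/p-p/2}.$$ Then for every $b\in\mathbb{R}^m$ with $b\neq 0$, every $s$-sparse solution $x\in\mathbb{R}^n$ of $Ax=b$, and every $v\in\ker(A)$, $$\frac{\|x\|_p^p}{\|x\|_2^p}\ \le\ \frac{\|x+v\|_p^p}{\|x+v\|_2^p}.$$
   Context: For $x\in\mathbb{R}^n$ and $p>0$, $\|x\|_p=\left(\sum_{i=1}^n|x_i|^p\right)^{1/p}$ (a quasi-norm for $0<p<1$). A vector is $s$-sparse if it has at most $s$ nonzero entries. For $T\subset\{1,\dots,n\}$, $T^c$ is its complement in $\{1,\dots,n\}$, and $v_T$ denotes the restriction of $v$ to the indices in $T$ (entries outside $T$ set to zero). Extended null space property (eNSP): given $p\in(0,1]$ and $c\in(0,1)$, a matrix $A\in\mathbb{R}^{m\times n}$ satisfies the eNSP of order $s$ (with exponent $p$ and parameter $c$) if $$(1-c)^{1/p}\|v_T\|_p\le c^{1/p}\|v_{T^c}\|_p\quad\text{for all } v\in\ker(A)\setminus\{0\}\text{ and all } T\subset\{1,\dots,n\}\text{ with }|T|\le s.$$ *)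

theory Defs
  imports "HOL-Analysis.Analysis"
begin

definition lpnorm :: "real \<Rightarrow> real ^ 'n \<Rightarrow> real" where
  "lpnorm p x = (\<Sum>i\<in>UNIV. \<bar>x $ i\<bar> powr p) powr (1 / p)"

text \<open>The case \<open>p = 2\<close> is the library's Euclidean norm, which is used for it throughout.\<close>

lemma lpnorm_2: "lpnorm 2 x = norm x"
  by (simp add: lpnorm_def norm_vec_def L2_set_def powr_half_sqrt sum_nonneg)

definition is_sparse :: "nat \<Rightarrow> real ^ 'n \<Rightarrow> bool" where
  "is_sparse s x \<longleftrightarrow> card {i. x $ i \<noteq> 0} \<le> s"

definition restrict_vec :: "real ^ 'n \<Rightarrow> 'n set \<Rightarrow> real ^ 'n" where
  "restrict_vec v T = (\<chi> i. if i \<in> T then v $ i else 0)"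

definition mat_ker :: "real ^ 'n ^ 'm \<Rightarrow> (real ^ 'n) set" where
  "mat_ker A = {v. A *v v = 0}"

text \<open>Only meaningful for \<open>0 < p \<le> 1\<close> and \<open>0 < c < 1\<close>; these ranges are not part of the predicate.\<close>

definition eNSP :: "real \<Rightarrow> real \<Rightarrow> nat \<Rightarrow> real ^ 'n ^ 'm \<Rightarrow> bool" where
  "eNSP p c s A \<longleftrightarrow>
    (\<forall>v \<in> mat_ker A - {0}. \<forall>T. card T \<le> s \<longrightarrow>
      (1 - c) powr (1 / p) * lpnorm p (restrict_vec v T)
        \<le> c powr (1 / p) * lpnorm p (restrict_vec v (- T)))"

text \<open>
  Infimum of the quotient over the nonzero kernel vectors. It is taken in the extended reals,
  so that it is \<open>\<infinity>\<close> when the kernel is trivial.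
\<close>

definition ker_ratio_inf :: "real \<Rightarrow> real ^ 'n ^ 'm \<Rightarrow> ereal" where
  "ker_ratio_inf p A = (INF v \<in> mat_ker A - {0}. ereal (lpnorm p v / norm v))"

end

theory Submission
  imports Defs
begin

text \<open>
  Write \<open>N v\<close> for the \<open>p\<close>-th power of the \<open>\<ell>\<^sup>p\<close> quasi-norm and \<open>\<theta> = s\<^bsup>-p/2 + p\<^sup>2/2\<^esup>\<close>.
  Splitting along the support of \<open>x\<close>, the null space property with \<open>1 - 2c = \<theta>/2\<close> yields
  \<open>N (x + v) \<ge> N x + (\<theta>/2) N v\<close>, while \<open>\<parallel>x + v\<parallel>\<^sup>p \<le> \<parallel>x\<parallel>\<^sup>p + \<parallel>v\<parallel>\<^sup>p\<close> as \<open>p \<le> 1\<close>. The claim thus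
  reduces to \<open>N x / \<parallel>x\<parallel>\<^sup>p \<le> (\<theta>/2) N v / \<parallel>v\<parallel>\<^sup>p\<close>. By sparsity the left side is at most
  \<open>s\<^bsup>1 - p/2\<^esup>\<close>, and by the ratio hypothesis the right side is at least
  \<open>\<theta> s\<^bsup>1 - p\<^sup>2/2\<^esup>\<close>, which is the same number.
\<close>

text \<open>Dividing by \<open>a + b\<close> turns the summands into shares in [0, 1] with sum 1,
  and each share \<open>t\<close> satisfies \<open>t \<le> t powr p\<close> because
  \<open>p \<le> 1\<close>.\<close>

lemma powr_add_le_add_powr:
  fixes a b p :: real
  assumes "0 < p" "p \<le> 1" "0 \<le> a" "0 \<le> b"
  shows "(a + b) powr p \<le> a powr p + b powr p"
proof (cases "a + b = 0")
  case True
  then show ?thesis by simp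
next
  case False
  then have pos: "a + b > 0" using assms by simp
  have le: "t \<le> t powr p" if "0 \<le> t" "t \<le> 1" for t :: real
    using powr_mono'[of p 1 t] that assms by simp
  have "1 = a / (a + b) + b / (a + b)"
    using pos by (simp add: add_divide_distrib [symmetric])
  also have "\<dots> \<le> (a / (a + b)) powr p + (b / (a + b)) powr p"
    using assms pos by (intro add_mono le) auto
  also have "\<dots> = (a powr p + b powr p) / (a + b) powr p"
    using assms pos by (simp add: powr_divide add_divide_distrib)
  finally show ?thesis
    using pos by (simp add: field_simps)
qed

lemma lpnorm_powr:
  assumes "0 < p"
  shows "lpnorm p x powr p = (\<Sum>i\<in>UNIV. \<bar>x $ i\<bar> powr p)"
  using assms by (simp add: lpnorm_def powr_powr sum_nonneg)

lemma lpnorm_nonneg: "0 \<le> lpnorm p x"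
  by (simp add: lpnorm_def)

lemma lpnorm_restrict_powr:
  assumes "0 < p"
  shows "lpnorm p (restrict_vec x T) powr p = (\<Sum>i\<in>T. \<bar>x $ i\<bar> powr p)"
proof -
  have "(\<Sum>i\<in>UNIV. \<bar>restrict_vec x T $ i\<bar> powr p) = (\<Sum>i\<in>UNIV. if i \<in> T then \<bar>x $ i\<bar> powr p else 0)"
    by (intro sum.cong) (auto simp: restrict_vec_def)
  then show ?thesis
    using assms by (simp add: lpnorm_powr sum.If_cases)
qed

text \<open>This is Hoelder's inequality on the support of \<open>x\<close>, comparing the p-th
  powers of the entries with the constant 1. It is obtained from Young's inequality entry by entry,
  after scaling by \<open>norm x\<close> and \<open>s\<close>.\<close>

lemma sparse_lpnorm_le_norm:
  fixes x :: "real ^ 'n"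
  assumes p: "0 < p" "p \<le> 2" and s: "1 \<le> s" "is_sparse s x"
  shows "lpnorm p x powr p \<le> real s powr (1 - p / 2) * norm x powr p"
proof (cases "x = 0")
  case True
  then show ?thesis using p by (simp add: lpnorm_powr)
next
  case False
  define S where "S = {i. x $ i \<noteq> 0}"
  have card: "real (card S) \<le> real s"
    using s by (simp add: is_sparse_def S_def)
  have nx: "norm x > 0" using False by simp
  \<comment> \<open>The weights are \<open>p / 2\<close> and \<open>1 - p / 2\<close>. Over
    \<open>S\<close> the squares sum to at most 1, and so do the terms \<open>1 / s\<close>, hence
    the right-hand sides sum to at most 1.\<close>
  have young: "(\<bar>x $ i\<bar> / norm x) powr p * (1 / real s) powr (1 - p / 2)
      \<le> p / 2 * (\<bar>x $ i\<bar> / norm x)\<^sup>2 + (1 - p / 2) * (1 / real s)" if "i \<in> S" for i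
  proof -
    have pos: "\<bar>x $ i\<bar> / norm x > 0" using that nx by (simp add: S_def)
    then have "((\<bar>x $ i\<bar> / norm x)\<^sup>2) powr (p / 2) = (\<bar>x $ i\<bar> / norm x) powr p"
      by (simp add: powr_powr flip: powr_numeral)
    then show ?thesis
      using Youngs_inequality_0[of "p / 2" "1 - p / 2" "(\<bar>x $ i\<bar> / norm x)\<^sup>2" "1 / real s"]
        p s(1) pos nx that by (simp add: S_def)
  qed
  have sq: "(\<Sum>i\<in>S. (\<bar>x $ i\<bar> / norm x)\<^sup>2) \<le> 1"
  proof -
    have "(\<Sum>i\<in>S. (\<bar>x $ i\<bar>)\<^sup>2) \<le> (\<Sum>i\<in>UNIV. (\<bar>x $ i\<bar>)\<^sup>2)"
      by (intro sum_mono2) auto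
    also have "\<dots> = (norm x)\<^sup>2"
      by (simp add: norm_vec_def L2_set_def sum_nonneg)
    finally show ?thesis
      using nx by (simp add: power_divide flip: sum_divide_distrib)
  qed
  have "lpnorm p x powr p = (\<Sum>i\<in>S. \<bar>x $ i\<bar> powr p)"
    using p(1) by (simp add: lpnorm_powr) (intro sum.mono_neutral_right, auto simp: S_def)
  then have "lpnorm p x powr p / norm x powr p * (1 / real s) powr (1 - p / 2)
      = (\<Sum>i\<in>S. (\<bar>x $ i\<bar> / norm x) powr p * (1 / real s) powr (1 - p / 2))"
    by (simp add: powr_divide sum_divide_distrib sum_distrib_right)
  also have "\<dots> \<le> (\<Sum>i\<in>S. p / 2 * (\<bar>x $ i\<bar> / norm x)\<^sup>2 + (1 - p / 2) * (1 / real s))"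
    by (intro sum_mono young)
  also have "\<dots> = p / 2 * (\<Sum>i\<in>S. (\<bar>x $ i\<bar> / norm x)\<^sup>2) + (1 - p / 2) * (real (card S) / real s)"
    by (simp only: sum.distrib sum_distrib_left sum_constant) simp
  also have "\<dots> \<le> p / 2 * 1 + (1 - p / 2) * 1"
    using sq card p s(1) by (intro add_mono mult_left_mono) auto
  finally show ?thesis
    using nx s(1) by (simp add: powr_divide field_simps)
qed

text \<open>On the support \<open>S\<close> of \<open>x\<close>, adding \<open>v\<close> costs at
  most the mass \<open>a\<close> of \<open>v\<close> there; off \<open>S\<close> it gains exactly
  the mass \<open>b\<close>. The null space property bounds the net gain \<open>b - a\<close> from
  below.\<close>

lemma eNSP_lpnorm_add:
  fixes A :: "real ^ 'n ^ 'm"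
  assumes p: "0 < p" "p \<le> 1" and c: "0 \<le> c" "c \<le> 1"
    and A: "eNSP p c s A" and v: "v \<in> mat_ker A" and x: "is_sparse s x"
  shows "lpnorm p x powr p + (1 - 2 * c) * lpnorm p v powr p \<le> lpnorm p (x + v) powr p"
proof (cases "v = 0")
  case True
  then show ?thesis using p by (simp add: lpnorm_powr)
next
  case False
  define S where "S = {i. x $ i \<noteq> 0}"
  define a where "a = (\<Sum>i\<in>S. \<bar>v $ i\<bar> powr p)"
  define b where "b = (\<Sum>i\<in>-S. \<bar>v $ i\<bar> powr p)"
  have split: "(\<Sum>i\<in>UNIV. f i) = (\<Sum>i\<in>S. f i) + (\<Sum>i\<in>-S. f i)" for f :: "'n \<Rightarrow> real"
    using sum.union_disjoint[of S "- S" f] by simp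
  have "(1 - c) powr (1 / p) * lpnorm p (restrict_vec v S)
      \<le> c powr (1 / p) * lpnorm p (restrict_vec v (- S))"
    using A v False x unfolding eNSP_def is_sparse_def S_def by blast
  then have "((1 - c) powr (1 / p) * lpnorm p (restrict_vec v S)) powr p
      \<le> (c powr (1 / p) * lpnorm p (restrict_vec v (- S))) powr p"
    using p by (intro powr_mono2) (auto simp: lpnorm_nonneg)
  then have ab: "(1 - c) * a \<le> c * b"
    using p c by (simp add: powr_mult powr_powr lpnorm_nonneg lpnorm_restrict_powr a_def b_def)
  have "\<bar>x $ i\<bar> powr p \<le> \<bar>(x + v) $ i\<bar> powr p + \<bar>v $ i\<bar> powr p" for i
  proof -
    have "\<bar>x $ i\<bar> powr p \<le> (\<bar>(x + v) $ i\<bar> + \<bar>v $ i\<bar>) powr p"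
      using p by (intro powr_mono2) auto
    also have "\<dots> \<le> \<bar>(x + v) $ i\<bar> powr p + \<bar>v $ i\<bar> powr p"
      using p by (intro powr_add_le_add_powr) auto
    finally show ?thesis .
  qed
  then have "(\<Sum>i\<in>S. \<bar>x $ i\<bar> powr p) \<le> (\<Sum>i\<in>S. \<bar>(x + v) $ i\<bar> powr p) + a"
    unfolding a_def by (simp only: sum.distrib [symmetric]) (intro sum_mono)
  moreover have "(\<Sum>i\<in>-S. \<bar>x $ i\<bar> powr p) = 0"
    by (intro sum.neutral) (auto simp: S_def)
  moreover have "(\<Sum>i\<in>-S. \<bar>(x + v) $ i\<bar> powr p) = b"
    unfolding b_def by (intro sum.cong) (auto simp: S_def)
  ultimately have "lpnorm p x powr p + b \<le> lpnorm p (x + v) powr p + a"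
    using p by (simp only: lpnorm_powr split)
  moreover have "lpnorm p v powr p = a + b"
    using p by (simp only: lpnorm_powr split a_def b_def)
  \<comment> \<open>Here \<open>b - a - (1 - 2 * c) * (a + b) = 2 * (c * b - (1 - c) * a)\<close>,
    which \<open>ab\<close> makes nonnegative.\<close>
  ultimately show ?thesis
    using ab by (simp add: algebra_simps)
qed

text \<open>The product form also covers \<open>v = 0\<close>, which the infimum leaves out.\<close>

lemma ker_ratio_inf_powr:
  fixes A :: "real ^ 'n ^ 'm"
  assumes "0 < p" "0 \<le> r" "ereal r \<le> ker_ratio_inf p A" "v \<in> mat_ker A"
  shows "r powr p * norm v powr p \<le> lpnorm p v powr p"
proof (cases "v = 0")
  case False
  then have "ker_ratio_inf p A \<le> ereal (lpnorm p v / norm v)"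
    using assms(4) unfolding ker_ratio_inf_def by (intro INF_lower) auto
  then have "ereal r \<le> ereal (lpnorm p v / norm v)"
    using assms(3) by (rule order_trans [rotated])
  then have "r * norm v \<le> lpnorm p v"
    using False by (simp add: field_simps)
  then have "(r * norm v) powr p \<le> lpnorm p v powr p"
    using assms by (intro powr_mono2) auto
  then show ?thesis
    using assms by (simp add: powr_mult)
qed simp

theorem theorem3p4:
  fixes A :: "real ^ 'n ^ 'm" and p :: real and s :: nat
  assumes "0 < p" and "p \<le> 1" and "1 \<le> s"
    and "eNSP p (1 / 2 - 1 / 4 * real s powr (- p / 2 + p\<^sup>2 / 2)) s A"
    and "ker_ratio_inf p A \<ge> ereal (2 powr (1 / p) * real s powr (1 / p - p / 2))"
  shows "\<forall>(b :: real ^ 'm) (x :: real ^ 'n) (v :: real ^ 'n).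
    b \<noteq> 0 \<longrightarrow> A *v x = b \<longrightarrow> is_sparse s x \<longrightarrow> v \<in> mat_ker A \<longrightarrow>
      lpnorm p x powr p / norm x powr p \<le> lpnorm p (x + v) powr p / norm (x + v) powr p"
proof (intro allI impI)
  fix b :: "real ^ 'm" and x v :: "real ^ 'n"
  assume b: "b \<noteq> 0" and Ax: "A *v x = b" and x: "is_sparse s x" and v: "v \<in> mat_ker A"
  define \<theta> where "\<theta> = real s powr (- p / 2 + p\<^sup>2 / 2)"
  define \<sigma> where "\<sigma> = real s powr (1 - p\<^sup>2 / 2)"
  define c where "c = 1 / 2 - 1 / 4 * \<theta>"
  let ?N = "\<lambda>u. lpnorm p u powr p" and ?E = "\<lambda>u :: real ^ 'n. norm u powr p"
  \<comment> \<open>This makes the exponent of \<open>s\<close> in \<theta> nonpositive, so \<theta>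
    is at most 1 and \<open>c\<close> lies between 1/4 and 1/2.\<close>
  have "p\<^sup>2 \<le> p"
    using assms(1,2) by (simp add: power2_eq_square mult_left_le)
  then have "\<theta> \<le> real s powr 0"
    unfolding \<theta>_def using assms(3) by (intro powr_mono) auto
  then have \<theta>: "0 \<le> \<theta>" "\<theta> \<le> 1"
    using assms(3) by (auto simp: \<theta>_def)
  \<comment> \<open>Both \<open>x\<close> and \<open>x + v\<close> solve the system with nonzero
    \<open>b\<close>, so neither vanishes and both quotients are genuine.\<close>
  have "A *v (x + v) = b"
    using Ax v by (simp add: mat_ker_def matrix_vector_right_distrib)
  then have nz: "norm x > 0" "norm (x + v) > 0"
    using b Ax by auto
  have numerator: "?N x + \<theta> / 2 * ?N v \<le> ?N (x + v)"
  proof -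
    have "eNSP p c s A"
      using assms(4) by (simp add: c_def \<theta>_def)
    then have "?N x + (1 - 2 * c) * ?N v \<le> ?N (x + v)"
      using assms(1,2) v x \<theta> by (intro eNSP_lpnorm_add) (auto simp: c_def)
    then show ?thesis by (simp add: c_def)
  qed
  have "?E (x + v) \<le> (norm x + norm v) powr p"
    using assms(1) by (intro powr_mono2 norm_triangle_ineq) auto
  also have "\<dots> \<le> ?E x + ?E v"
    using assms(1,2) by (intro powr_add_le_add_powr) auto
  finally have denominator: "?E (x + v) \<le> ?E x + ?E v" .
  have "(2 powr (1 / p) * real s powr (1 / p - p / 2)) powr p = 2 * \<sigma>"
    using assms(1) by (simp add: \<sigma>_def powr_mult powr_powr left_diff_distrib power2_eq_square)
  then have ratio: "2 * \<sigma> * ?E v \<le> ?N v"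
    using ker_ratio_inf_powr[OF assms(1) _ assms(5) v] by simp
  have "real s powr (1 - p / 2) = \<theta> * \<sigma>"
    by (simp add: \<theta>_def \<sigma>_def flip: powr_add)
  then have sparse: "?N x \<le> \<theta> * \<sigma> * ?E x"
    using sparse_lpnorm_le_norm[of p s x] assms(1-3) x by simp
  \<comment> \<open>The comparison of quotients is kept cross-multiplied, since \<open>v\<close> may
    be zero.\<close>
  have "?N x * ?E v \<le> \<theta> * \<sigma> * ?E x * ?E v"
    using sparse by (intro mult_right_mono) auto
  also have "\<dots> = ?E x * (\<theta> / 2) * (2 * \<sigma> * ?E v)"
    by simp
  also have "\<dots> \<le> ?E x * (\<theta> / 2) * ?N v"
    using ratio \<theta> by (intro mult_left_mono) auto
  finally have cross: "?N x * ?E v \<le> ?E x * (\<theta> / 2) * ?N v" .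
  have "?N x * ?E (x + v) \<le> ?N x * (?E x + ?E v)"
    using denominator by (intro mult_left_mono) auto
  also have "\<dots> \<le> (?N x + \<theta> / 2 * ?N v) * ?E x"
    using cross by (simp add: algebra_simps)
  also have "\<dots> \<le> ?N (x + v) * ?E x"
    using numerator by (intro mult_right_mono) auto
  finally show "?N x / ?E x \<le> ?N (x + v) / ?E (x + v)"
    using nz by (simp add: field_simps)
qed

end
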